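(* For all integers $n,T>0$, there exists a principal-agent problem $(\mathbf c,\mathbf F,\mathbf r)$ with $T$ types, $n+1$ actions, and two outcomes that satisfies $$\mathrm{OptMenu}(\mathbf c,\mathbf F,\mathbf r)\ \le\ O\left(\frac{1}{n\log T}\right)\mathrm{Welfare}(\mathbf c,\mathbf F,\mathbf r).$$
   Context: A (typed) principal-agent problem $(\mathbf c,\mathbf F,\mathbf r)$ with $N$ actions, $m$ outcomes and $T$ types consists of: costs $\mathbf c\in\mathbb R_{\ge 0}^N$ (the same for all types) with $0=c_1\le c_2\le\dots\le c_N$; rewards $\mathbf r\in\mathbb R_{\ge0}^m$ with $0=r_1\le\dots\le r_m$; and, for each type $t\in[T]$ and action $i\in[N]$, a probability distribution $(F^{(t)}_{i,j})_{j\in[m]}$ over outcomes. The agent's type is uniform on $[T]$; $\mathbb E_t$ denotes the expectation over it. Let $R^{(t)}_i=\sum_jF^{(t)}_{i,j}r_j$. A contract is a vector $\mathbf x\in\mathbb R_{\ge0}^m$. Under $\mathbf x$, an agent of type $t$ plays an action $i_*^{(t)}(\mathbf x)\in\arg\max_i\big(\sum_j F^{(t)}_{i,j}x_j-c_i\big)$, ties being broken so as to maximize the principal's profit $\mathrm{Profit}^{(t)}(\mathbf x)=\sum_j F^{(t)}_{i_*^{(t)}(\mathbf x),j}(r_j-x_j)$. $\mathrm{Welfare}=\mathbb E_t[\max_i(R^{(t)}_i-c_i)]$. A menu $X=(\mathbf x^{(1)},\dots,\mathbf x^{(T)})$ assigns one contract per type; it is incentive-compatible (IC) if for all $t,t'\in[T]$: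 $\max_i\big(\sum_jF^{(t)}_{i,j}x^{(t)}_j-c_i\big)\ge\max_i\big(\sum_jF^{(t)}_{i,j}x^{(t')}_j-c_i\big)$. $\mathrm{OptMenu}$ is the maximum of $\mathbb E_t[\mathrm{Profit}^{(t)}(\mathbf x^{(t)})]$ over IC menus. The constant hidden in $O$ is absolute. *)

theory Defs
  imports Complex_Main
begin

(* Actions, outcomes and types are numbered from 1, and a vector is a function on nat of which only
   the entries in the respective range {1..num_...} matter.  prob P t i j is F^(t)_{i,j}. *)

record pa_problem =
  num_actions :: nat
  num_outcomes :: nat
  num_types :: nat
  cost :: "nat \<Rightarrow> real"
  prob :: "nat \<Rightarrow> nat \<Rightarrow> nat \<Rightarrow> real"
  reward :: "nat \<Rightarrow> real"

definition principal_agent_problem :: "pa_problem \<Rightarrow> bool" where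
  "principal_agent_problem P \<longleftrightarrow>
     1 \<le> num_actions P \<and> 1 \<le> num_outcomes P \<and> 1 \<le> num_types P \<and>
     cost P 1 = 0 \<and> mono_on {1..num_actions P} (cost P) \<and>
     reward P 1 = 0 \<and> mono_on {1..num_outcomes P} (reward P) \<and>
     (\<forall>t\<in>{1..num_types P}. \<forall>i\<in>{1..num_actions P}.
        (\<forall>j\<in>{1..num_outcomes P}. 0 \<le> prob P t i j) \<and>
        (\<Sum>j\<in>{1..num_outcomes P}. prob P t i j) = 1)"

definition expected_reward :: "pa_problem \<Rightarrow> nat \<Rightarrow> nat \<Rightarrow> real" where
  "expected_reward P t i = (\<Sum>j\<in>{1..num_outcomes P}. prob P t i j * reward P j)"

definition contract :: "pa_problem \<Rightarrow> (nat \<Rightarrow> real) \<Rightarrow> bool" where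
  "contract P x \<longleftrightarrow> (\<forall>j\<in>{1..num_outcomes P}. 0 \<le> x j)"

definition agent_utility :: "pa_problem \<Rightarrow> nat \<Rightarrow> (nat \<Rightarrow> real) \<Rightarrow> nat \<Rightarrow> real" where
  "agent_utility P t x i = (\<Sum>j\<in>{1..num_outcomes P}. prob P t i j * x j) - cost P i"

definition max_utility :: "pa_problem \<Rightarrow> nat \<Rightarrow> (nat \<Rightarrow> real) \<Rightarrow> real" where
  "max_utility P t x = Max (agent_utility P t x ` {1..num_actions P})"

definition best_responses :: "pa_problem \<Rightarrow> nat \<Rightarrow> (nat \<Rightarrow> real) \<Rightarrow> nat set" where
  "best_responses P t x =
     {i. is_arg_max (agent_utility P t x) (\<lambda>k. k \<in> {1..num_actions P}) i}"

definition action_profit :: "pa_problem \<Rightarrow> nat \<Rightarrow> (nat \<Rightarrow> real) \<Rightarrow> nat \<Rightarrow> real" where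
  "action_profit P t x i = (\<Sum>j\<in>{1..num_outcomes P}. prob P t i j * (reward P j - x j))"

(* The action i_*: ties among the agent's best responses are broken in the principal's favour
   (any ties that remain do not affect the profit). *)
definition played_action :: "pa_problem \<Rightarrow> nat \<Rightarrow> (nat \<Rightarrow> real) \<Rightarrow> nat" where
  "played_action P t x = arg_max (action_profit P t x) (\<lambda>i. i \<in> best_responses P t x)"

definition profit :: "pa_problem \<Rightarrow> nat \<Rightarrow> (nat \<Rightarrow> real) \<Rightarrow> real" where
  "profit P t x = action_profit P t x (played_action P t x)"

definition type_expectation :: "pa_problem \<Rightarrow> (nat \<Rightarrow> real) \<Rightarrow> real" where
  "type_expectation P f = (\<Sum>t\<in>{1..num_types P}. f t) / real (num_types P)"

definition welfare :: "pa_problem \<Rightarrow> real" where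
  "welfare P = type_expectation P
     (\<lambda>t. Max ((\<lambda>i. expected_reward P t i - cost P i) ` {1..num_actions P}))"

definition ic_menu :: "pa_problem \<Rightarrow> (nat \<Rightarrow> nat \<Rightarrow> real) \<Rightarrow> bool" where
  "ic_menu P X \<longleftrightarrow>
     (\<forall>t\<in>{1..num_types P}. contract P (X t)) \<and>
     (\<forall>t\<in>{1..num_types P}. \<forall>t'\<in>{1..num_types P}. max_utility P t (X t) \<ge> max_utility P t (X t'))"

definition menu_profit :: "pa_problem \<Rightarrow> (nat \<Rightarrow> nat \<Rightarrow> real) \<Rightarrow> real" where
  "menu_profit P X = type_expectation P (\<lambda>t. profit P t (X t))"

(* The supremum is over a nonempty set that is bounded above (proved below), so it equals the
   maximum whenever that is attained, and opt_menu P <= B iff every IC menu has profit at most B. *)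
definition opt_menu :: "pa_problem \<Rightarrow> real" where
  "opt_menu P = (SUP X\<in>{X. ic_menu P X}. menu_profit P X)"

lemma finite_is_arg_max:
  fixes f :: "'a \<Rightarrow> real"
  assumes "finite A" "A \<noteq> {}"
  shows "\<exists>i. is_arg_max f (\<lambda>k. k \<in> A) i"
proof -
  have "Max (f ` A) \<in> f ` A" using assms by simp
  then obtain i where i: "i \<in> A" "f i = Max (f ` A)" by auto
  have "f k \<le> f i" if "k \<in> A" for k using that assms i by simp
  then show ?thesis using i by (intro exI[of _ i]) (simp add: is_arg_max_def not_less)
qed

lemma played_action_best_response:
  assumes "principal_agent_problem P"
  shows "is_arg_max (action_profit P t x) (\<lambda>i. i \<in> best_responses P t x) (played_action P t x)"
proof -
  have "{1..num_actions P} \<noteq> {}" using assms by (auto simp: principal_agent_problem_def)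
  then have "best_responses P t x \<noteq> {}"
    unfolding best_responses_def using finite_is_arg_max[of "{1..num_actions P}" "agent_utility P t x"] by blast
  moreover have "finite (best_responses P t x)"
    by (rule finite_subset[of _ "{1..num_actions P}"]) (auto simp: best_responses_def is_arg_max_def)
  ultimately have "\<exists>i. is_arg_max (action_profit P t x) (\<lambda>i. i \<in> best_responses P t x) i"
    by (rule finite_is_arg_max[rotated])
  then show ?thesis unfolding played_action_def arg_max_def by (rule someI_ex)
qed

lemma ic_menu_zero: "ic_menu P (\<lambda>t j. 0)"
  by (simp add: ic_menu_def contract_def)

lemma bdd_above_menu_profit:
  assumes P: "principal_agent_problem P"
  shows "bdd_above (menu_profit P ` {X. ic_menu P X})"
proof (rule bdd_aboveI2)
  fix X assume "X \<in> {X. ic_menu P X}"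
  then have X: "ic_menu P X" by simp
  have "profit P t (X t) \<le> reward P (num_outcomes P)" if t: "t \<in> {1..num_types P}" for t
  proof -
    define i where "i = played_action P t (X t)"
    have i: "i \<in> {1..num_actions P}"
      using played_action_best_response[OF P, of t "X t"]
      by (auto simp: i_def is_arg_max_def best_responses_def)
    have F: "\<forall>j\<in>{1..num_outcomes P}. 0 \<le> prob P t i j" "(\<Sum>j\<in>{1..num_outcomes P}. prob P t i j) = 1"
      using P t i by (auto simp: principal_agent_problem_def)
    have "prob P t i j * (reward P j - X t j) \<le> prob P t i j * reward P (num_outcomes P)"
      if j: "j \<in> {1..num_outcomes P}" for j
    proof -
      have "reward P j \<le> reward P (num_outcomes P)"
        using P j by (auto simp: principal_agent_problem_def intro: mono_onD)
      moreover have "0 \<le> X t j" using X t j by (auto simp: ic_menu_def contract_def)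
      ultimately show ?thesis using F(1) j by (intro mult_left_mono) auto
    qed
    then have "profit P t (X t) \<le> (\<Sum>j\<in>{1..num_outcomes P}. prob P t i j * reward P (num_outcomes P))"
      unfolding profit_def action_profit_def i_def[symmetric] by (rule sum_mono)
    then show ?thesis using F(2) by (simp add: sum_distrib_right[symmetric])
  qed
  then have "(\<Sum>t\<in>{1..num_types P}. profit P t (X t)) \<le> real (num_types P) * reward P (num_outcomes P)"
    using sum_bounded_above[of "{1..num_types P}" "\<lambda>t. profit P t (X t)" "reward P (num_outcomes P)"]
    by simp
  moreover have "0 < real (num_types P)" using P by (simp add: principal_agent_problem_def)
  ultimately show "menu_profit P X \<le> reward P (num_outcomes P)"
    unfolding menu_profit_def type_expectation_def by (subst pos_divide_le_eq) (simp_all only: mult.commute)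
qed

end

theory Submission
  imports Defs "HOL-Analysis.Harmonic_Numbers"
begin

text \<open>
  With two outcomes (failure and success) a contract is a base payment \<open>x 1 \<ge> 0\<close> plus a bonus
  \<open>x 2 - x 1\<close> for success. Let \<open>s\<close> be the largest bonus in an IC menu. A type could deviate to
  that contract while keeping its action, so it is paid at least \<open>s\<close> per unit of success
  probability, and convexity shows that it would exert at least as much effort under bonus \<open>s\<close>;
  hence menus are no better than a single bonus.

  In the hard instance, with \<open>B = T + 1\<close>, the \<open>k\<close>-th effort step (\<open>k < n\<close>) has marginal cost
  \<open>c B ^ k\<close> for a constant \<open>c\<close>, and type \<open>t\<close> takes it exactly if the bonus is at least
  \<open>1 - 1 / (2 t B ^ k)\<close>. Each step adds about \<open>c / (2 t)\<close> to the welfare of type \<open>t\<close>, which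
  gives \<open>c n ln T / 2\<close> in total. For a bonus \<open>1 - \<delta>\<close>, only the last step taken matters, since
  costs are geometric, and within a step the types form an equal-revenue distribution, so that
  the total profit is \<open>O(c)\<close>.
\<close>

section \<open>Reduction of menus to a single bonus\<close>

text \<open>The type's own bonus serves as \<open>s'\<close>: its action is optimal there, while the
  largest bonus \<open>s\<close> bounds its pay from below. Keeping \<open>s' \<le> s\<close> stands
  in for the convexity argument, since a lower bound on \<open>s'\<close> passes on to
  \<open>s\<close>.\<close>

lemma menu_profit_le_single_bonus:
  assumes P: "principal_agent_problem P" and out: "num_outcomes P = 2" and X: "ic_menu P X"
  shows "\<exists>s. \<forall>t\<in>{1..num_types P}. \<exists>i\<in>{1..num_actions P}. \<exists>s'\<le>s.
           (\<forall>k\<in>{1..num_actions P}. prob P t k 2 * s' - cost P k \<le> prob P t i 2 * s' - cost P i) \<and>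
           profit P t (X t) \<le> prob P t i 2 * (reward P 2 - s)"
proof -
  define b where "b = (\<lambda>t. X t 2 - X t 1)"
  have ne: "{1..num_types P} \<noteq> {}"
    using P by (simp add: principal_agent_problem_def)
  have S: "{Suc 0..2} = {Suc 0, 2}" by auto
  have "Max (b ` {1..num_types P}) \<in> b ` {1..num_types P}" using ne by simp
  then obtain u where u: "u \<in> {1..num_types P}" "b u = Max (b ` {1..num_types P})" by auto
  have fail: "prob P t i (Suc 0) = 1 - prob P t i 2"
    if "t \<in> {1..num_types P}" "i \<in> {1..num_actions P}" for t i
  proof -
    have "prob P t i (Suc 0) + prob P t i 2 = 1"
      using P that by (simp add: principal_agent_problem_def out S)
    then show ?thesis by linarith
  qed
  have util: "agent_utility P t (X t') i = X t' 1 + prob P t i 2 * b t' - cost P i"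
    if "t \<in> {1..num_types P}" "i \<in> {1..num_actions P}" for t t' i
    by (simp add: fail[OF that] agent_utility_def out S b_def algebra_simps)
  show ?thesis
  proof (intro exI[of _ "b u"] ballI)
    fix t assume t: "t \<in> {1..num_types P}"
    define i where "i = played_action P t (X t)"
    have br: "i \<in> best_responses P t (X t)"
      using played_action_best_response[OF P, of t "X t"] by (simp add: i_def is_arg_max_def)
    then have i: "i \<in> {1..num_actions P}"
      and opt: "\<And>k. k \<in> {1..num_actions P} \<Longrightarrow> agent_utility P t (X t) k \<le> agent_utility P t (X t) i"
      by (auto simp: best_responses_def is_arg_max_def not_less)
    \<comment> \<open>Type \<open>t\<close> deviates to the contract of \<open>u\<close> but keeps
      action \<open>i\<close>, so the cost cancels and incentive compatibility compares payments
      alone.\<close>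
    have "agent_utility P t (X u) i \<le> max_utility P t (X u)"
      unfolding max_utility_def using i by (intro Max_ge) auto
    also have "\<dots> \<le> max_utility P t (X t)"
      using X t u(1) unfolding ic_menu_def by blast
    also have "\<dots> \<le> agent_utility P t (X t) i"
      unfolding max_utility_def using opt i by (intro Max.boundedI) auto
    finally have dev: "X u 1 + prob P t i 2 * b u \<le> X t 1 + prob P t i 2 * b t"
      using util t i by simp
    have base: "0 \<le> X u 1" using X u(1) by (simp add: ic_menu_def contract_def out)
    have "profit P t (X t) = prob P t i 2 * reward P 2 - (X t 1 + prob P t i 2 * b t)"
      using P
      by (simp add: fail[OF t i] profit_def action_profit_def i_def[symmetric] out S b_def
          principal_agent_problem_def algebra_simps)
    then have "profit P t (X t) \<le> prob P t i 2 * (reward P 2 - b u)"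
      using dev base by (simp add: algebra_simps)
    moreover have "b t \<le> b u" using u t by simp
    moreover have "prob P t k 2 * b t - cost P k \<le> prob P t i 2 * b t - cost P i"
      if "k \<in> {1..num_actions P}" for k
      using opt[OF that] util[OF t that, of t] util[OF t i, of t] by simp
    ultimately show "\<exists>i\<in>{1..num_actions P}. \<exists>s'\<le>b u.
           (\<forall>k\<in>{1..num_actions P}. prob P t k 2 * s' - cost P k \<le> prob P t i 2 * s' - cost P i) \<and>
           profit P t (X t) \<le> prob P t i 2 * (reward P 2 - b u)"
      using i by blast
  qed
qed

section \<open>Sums of powers\<close>

lemma sum_power_lessThan_Suc_le:
  fixes B :: real
  assumes "2 \<le> B"
  shows "(\<Sum>k<Suc j. B ^ k) \<le> 2 * B ^ j"
proof (induction j)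
  case (Suc j)
  have "2 * B ^ j \<le> B * B ^ j" using assms by (intro mult_right_mono) auto
  then show ?case using Suc by simp
qed simp

text \<open>Among the powers \<open>B ^ k \<le> D / t\<close>, only the largest power \<open>B ^ K \<le> D\<close> needs to be counted
  carefully: it occurs for at most \<open>D / B ^ K\<close> values of \<open>t\<close>, and otherwise the bound
  \<open>B ^ K / B\<close> is summed at most \<open>T \<le> B\<close> times.\<close>
lemma sum_power_bound:
  fixes B D :: real and f :: "nat \<Rightarrow> real"
  assumes B: "1 < B" "real T \<le> B" and D: "0 \<le> D"
    and f: "\<And>t. t \<in> {1..T} \<Longrightarrow> f t \<le> 0 \<or> (\<exists>k. f t \<le> B ^ k \<and> real t * B ^ k \<le> D)"
  shows "(\<Sum>t\<in>{1..T}. f t) \<le> 2 * D"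
proof (cases "D < 1")
  case True
  have "f t \<le> 0" if t: "t \<in> {1..T}" for t
  proof -
    have "1 * 1 \<le> real t * B ^ k" for k
      using t B by (intro mult_mono one_le_power) auto
    then have "\<not> real t * B ^ k \<le> D" for k
      using True by (metis less_le_trans mult_1 not_less)
    then show ?thesis using f[OF t] by blast
  qed
  then have "(\<Sum>t\<in>{1..T}. f t) \<le> 0" by (rule sum_nonpos)
  then show ?thesis using D by simp
next
  case False
  \<comment> \<open>\<open>K = N - 1\<close> is the largest exponent with
    \<open>B ^ K \<le> D\<close>; it exists because \<open>D \<ge> 1 = B ^ 0\<close>.\<close>
  define N where "N = (LEAST N. D < B ^ N)"
  have N: "D < B ^ N"
    unfolding N_def using real_arch_pow[OF B(1), of D] by (rule LeastI_ex)
  then have "N \<noteq> 0" using False by (intro notI) auto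
  then obtain K where K: "N = Suc K" using not0_implies_Suc by blast
  have KD: "B ^ K \<le> D"
    using not_less_Least[of K "\<lambda>N. D < B ^ N"] K by (simp add: N_def not_less)
  define A where "A = {t\<in>{1..T}. real t * B ^ K \<le> D}"
  have ft: "f t \<le> (if t \<in> A then B ^ K else 0) + B ^ K / B" if t: "t \<in> {1..T}" for t
  proof (cases "f t \<le> 0")
    case True
    moreover have "0 \<le> (if t \<in> A then B ^ K else 0) + B ^ K / B" using B by auto
    ultimately show ?thesis by linarith
  next
    case False
    then obtain k where k: "f t \<le> B ^ k" "real t * B ^ k \<le> D" using f[OF t] by blast
    have "1 * B ^ k \<le> real t * B ^ k" using t B by (intro mult_right_mono) auto
    then have "B ^ k < B ^ Suc K" using k N K by simp
    then have "k < Suc K" using B by (simp only: power_strict_increasing_iff)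
    then consider "k = K" | "Suc k \<le> K" by linarith
    then show ?thesis
    proof cases
      case 1
      then have "t \<in> A" using k t by (simp add: A_def)
      then show ?thesis using k 1 B by (simp add: add_increasing2)
    next
      case 2
      then have "B ^ Suc k \<le> B ^ K" using B by (intro power_increasing) auto
      then have "B ^ k \<le> B ^ K / B" using B by (simp add: field_simps)
      moreover have "0 \<le> (if t \<in> A then B ^ K else 0)" using B by auto
      ultimately show ?thesis using k by linarith
    qed
  qed
  have "A \<subseteq> {1..nat \<lfloor>D / B ^ K\<rfloor>}"
    using B by (auto simp: A_def le_nat_floor field_simps)
  then have "card A \<le> nat \<lfloor>D / B ^ K\<rfloor>"
    using card_mono[of "{1..nat \<lfloor>D / B ^ K\<rfloor>}" A] by simp
  then have "real (card A) \<le> D / B ^ K"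
    using D B by (simp add: le_nat_floor le_floor_iff nat_le_iff le_nat_iff)
  then have cA: "real (card A) * B ^ K \<le> D" using B by (simp add: field_simps)
  have "real T * (B ^ K / B) \<le> B * (B ^ K / B)" using B by (intro mult_right_mono) auto
  then have rest: "real T * (B ^ K / B) \<le> D" using B KD by simp
  have "(\<Sum>t\<in>{1..T}. f t) \<le> (\<Sum>t\<in>{1..T}. (if t \<in> A then B ^ K else 0) + B ^ K / B)"
    using ft by (rule sum_mono)
  also have "\<dots> = (\<Sum>t\<in>{1..T}. if t \<in> A then B ^ K else 0) + real T * (B ^ K / B)"
    by (simp add: sum.distrib)
  also have "(\<Sum>t\<in>{1..T}. if t \<in> A then B ^ K else 0) = real (card A) * B ^ K"
  proof -
    have "{1..T} \<inter> A = A" by (auto simp: A_def)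
    then show ?thesis by (simp add: sum.If_cases)
  qed
  finally show ?thesis using cA rest by simp
qed

section \<open>The hard instance\<close>

text \<open>The constant \<open>c\<close> of the overview, scaled so that four times any step cost
  with exponent at most \<open>n\<close> is at most 1; this keeps success probabilities below
  1.\<close>

definition unit_cost :: "nat \<Rightarrow> nat \<Rightarrow> real" where
  "unit_cost n T = 1 / (4 * (real T + 1) ^ n)"

definition step_cost :: "nat \<Rightarrow> nat \<Rightarrow> nat \<Rightarrow> real" where
  "step_cost n T k = unit_cost n T * (real T + 1) ^ k"

text \<open>The 2 in the denominator keeps every threshold at least 1/2, so a step gains at most
  twice its cost in success probability.\<close>

definition step_bonus :: "nat \<Rightarrow> nat \<Rightarrow> nat \<Rightarrow> real" where
  "step_bonus T t k = 1 - 1 / (2 * real t * (real T + 1) ^ k)"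

text \<open>Action \<open>i\<close> takes the effort steps \<open>k < i - 1\<close>, so that action 1 is the null action.\<close>
definition success :: "nat \<Rightarrow> nat \<Rightarrow> nat \<Rightarrow> nat \<Rightarrow> real" where
  "success n T t i = (\<Sum>k<i - 1. step_cost n T k / step_bonus T t k)"

definition hard_problem :: "nat \<Rightarrow> nat \<Rightarrow> pa_problem" where
  "hard_problem n T = \<lparr>num_actions = n + 1, num_outcomes = 2, num_types = T,
     cost = (\<lambda>i. \<Sum>k<i - 1. step_cost n T k),
     prob = (\<lambda>t i j. if j = 2 then success n T t i else 1 - success n T t i),
     reward = (\<lambda>j. if j = 2 then 1 else 0)\<rparr>"

lemma hard_problem_simps [simp]:
  "num_actions (hard_problem n T) = Suc n"
  "num_outcomes (hard_problem n T) = 2"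
  "num_types (hard_problem n T) = T"
  "cost (hard_problem n T) i = (\<Sum>k<i - 1. step_cost n T k)"
  "prob (hard_problem n T) t i j = (if j = 2 then success n T t i else 1 - success n T t i)"
  "reward (hard_problem n T) j = (if j = 2 then 1 else 0)"
  by (simp_all add: hard_problem_def)

lemma unit_cost_pos: "0 < unit_cost n T"
  by (simp add: unit_cost_def add_nonneg_pos)

lemma step_cost_pos: "0 < step_cost n T k"
  using unit_cost_pos by (simp add: step_cost_def add_nonneg_pos)

lemma step_bonus_bounds:
  assumes "1 \<le> t"
  shows "1 / 2 \<le> step_bonus T t k" "step_bonus T t k < 1"
proof -
  have "1 * 1 \<le> real t * (real T + 1) ^ k"
    using assms by (intro mult_mono one_le_power) auto
  then show "1 / 2 \<le> step_bonus T t k" "step_bonus T t k < 1"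
    by (simp_all add: step_bonus_def field_simps)
qed

text \<open>One factor 2 comes from thresholds being at least 1/2, the other from the geometric sum
  being at most twice its last term.\<close>

lemma success_le:
  assumes "1 \<le> t" "1 \<le> T"
  shows "success n T t (Suc (Suc j)) \<le> 4 * step_cost n T j"
proof -
  have "success n T t (Suc (Suc j)) \<le> (\<Sum>k<Suc j. 2 * step_cost n T k)"
    unfolding success_def diff_Suc_1
  proof (rule sum_mono)
    fix k
    have "step_cost n T k / step_bonus T t k \<le> step_cost n T k / (1 / 2)"
      using step_bonus_bounds[OF assms(1), of T k] step_cost_pos[of n T k]
      by (intro divide_left_mono) auto
    then show "step_cost n T k / step_bonus T t k \<le> 2 * step_cost n T k" by simp
  qed
  also have "\<dots> = 2 * unit_cost n T * (\<Sum>k<Suc j. (real T + 1) ^ k)"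
    by (simp only: step_cost_def sum_distrib_left mult.assoc)
  also have "\<dots> \<le> 2 * unit_cost n T * (2 * (real T + 1) ^ j)"
    using assms unit_cost_pos[of n T]
    by (intro mult_left_mono sum_power_lessThan_Suc_le) auto
  finally show ?thesis by (simp add: step_cost_def)
qed

lemma success_bounds:
  assumes "1 \<le> t" "1 \<le> T" "i \<le> Suc n"
  shows "0 \<le> success n T t i" "success n T t i \<le> 1"
proof -
  have "0 \<le> step_cost n T k / step_bonus T t k" for k
    using step_bonus_bounds[OF assms(1), of T k] step_cost_pos[of n T k] by auto
  then show "0 \<le> success n T t i" unfolding success_def by (intro sum_nonneg)
  show "success n T t i \<le> 1"
  proof (cases "i \<le> 1")
    case True
    then show ?thesis by (simp add: success_def)
  next
    case False
    then obtain j where j: "i = Suc (Suc j)" by (metis One_nat_def le_SucI nat_le_linear not0_implies_Suc zero_le)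
    have "(real T + 1) ^ j \<le> (real T + 1) ^ n" using assms(3) j by (intro power_increasing) auto
    then have "4 * step_cost n T j \<le> 1"
      by (simp add: step_cost_def unit_cost_def add_nonneg_pos)
    then show ?thesis using success_le[OF assms(1,2), of n j] j by simp
  qed
qed

lemma hard_problem_valid:
  assumes "1 \<le> T"
  shows "principal_agent_problem (hard_problem n T)"
proof -
  have S: "{Suc 0..2} = {Suc 0, 2}" by auto
  have "mono_on {1..Suc n} (\<lambda>i. \<Sum>k<i - 1. step_cost n T k)"
    using step_cost_pos by (intro mono_onI sum_mono2) (auto intro: less_imp_le)
  then show ?thesis
    using assms success_bounds
    by (auto simp: principal_agent_problem_def S mono_on_def)
qed

section \<open>Upper bound on the profit of menus\<close>

lemma hard_problem_profit_sum:
  assumes T: "1 \<le> T" and X: "ic_menu (hard_problem n T) X"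
  shows "(\<Sum>t\<in>{1..T}. profit (hard_problem n T) t (X t)) \<le> 4 * unit_cost n T"
proof -
  define P where "P = hard_problem n T"
  have "\<exists>s. \<forall>t\<in>{1..T}. \<exists>i\<in>{1..Suc n}. \<exists>s'\<le>s.
      (\<forall>k\<in>{1..Suc n}. success n T t k * s' - cost P k \<le> success n T t i * s' - cost P i) \<and>
      profit P t (X t) \<le> success n T t i * (1 - s)"
    using menu_profit_le_single_bonus[OF hard_problem_valid[OF T] _ X] by (simp add: P_def)
  then obtain s where s: "\<And>t. t \<in> {1..T} \<Longrightarrow> \<exists>i\<in>{1..Suc n}. \<exists>s'\<le>s.
      (\<forall>k\<in>{1..Suc n}. success n T t k * s' - cost P k \<le> success n T t i * s' - cost P i) \<and>
      profit P t (X t) \<le> success n T t i * (1 - s)" by blast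
  show ?thesis
  proof (cases "1 \<le> s")
    case True
    have "profit P t (X t) \<le> 0" if t: "t \<in> {1..T}" for t
    proof -
      obtain i where i: "i \<in> {1..Suc n}" "profit P t (X t) \<le> success n T t i * (1 - s)"
        using s[OF t] by blast
      have "success n T t i * (1 - s) \<le> 0"
        using success_bounds(1)[of t T i n] t T i True by (intro mult_nonneg_nonpos) auto
      then show ?thesis using i by linarith
    qed
    then have "(\<Sum>t\<in>{1..T}. profit P t (X t)) \<le> 0" by (rule sum_nonpos)
    then show ?thesis using unit_cost_pos[of n T] by (simp add: P_def)
  next
    case False
    define d where "d = 1 - s"
    have d: "0 < d" using False by (simp add: d_def)
    \<comment> \<open>By \<open>success_le\<close>, a type whose last step is \<open>j\<close>
      yields at most \<open>4 * unit_cost n T * (real T + 1) ^ j * d\<close>; dividing by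
      \<open>h\<close> leaves the bare power.\<close>
    define h where "h = 4 * unit_cost n T * d"
    have h: "0 < h" using d unit_cost_pos by (simp add: h_def)
    have "profit P t (X t) / h \<le> 0 \<or>
        (\<exists>k. profit P t (X t) / h \<le> (real T + 1) ^ k \<and> real t * (real T + 1) ^ k \<le> 1 / (2 * d))"
      if t: "t \<in> {1..T}" for t
    proof -
      have t1: "1 \<le> t" using t by simp
      obtain i s' where i: "i \<in> {1..Suc n}" and s': "s' \<le> s"
        and opt: "\<And>k. k \<in> {1..Suc n} \<Longrightarrow>
          success n T t k * s' - cost P k \<le> success n T t i * s' - cost P i"
        and pr: "profit P t (X t) \<le> success n T t i * d"
        using s[OF t] unfolding d_def by blast
      show ?thesis
      proof (cases "i = 1")
        case True
        then have "profit P t (X t) \<le> 0" using pr by (simp add: success_def)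
        then show ?thesis using h by (simp add: divide_le_0_iff)
      next
        case False
        then obtain j where j: "i = Suc (Suc j)"
          using i by (metis One_nat_def atLeastAtMost_iff not0_implies_Suc not_one_le_zero)
        let ?c = "step_cost n T j" and ?y = "step_bonus T t j"
        \<comment> \<open>Comparing with the action that omits only the last step \<open>j\<close>
          shows that \<open>s'\<close>, hence \<open>s\<close>, reaches the threshold of that
          step.\<close>
        have "success n T t (Suc j) * s' - cost P (Suc j) \<le> success n T t i * s' - cost P i"
          using i j by (intro opt) auto
        then have "0 \<le> ?c / ?y * s' - ?c"
          by (simp add: j P_def success_def algebra_simps)
        then have "?y \<le> s'"
          using step_bonus_bounds(1)[OF t1, of T j] step_cost_pos[of n T j]
          by (simp add: field_simps)
        then have "d \<le> 1 / (2 * real t * (real T + 1) ^ j)"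
          using s' by (simp add: d_def step_bonus_def)
        moreover have "0 < (real T + 1) ^ j" by (simp add: add_nonneg_pos)
        ultimately have "real t * (real T + 1) ^ j \<le> 1 / (2 * d)"
          using d t1 by (simp add: field_simps)
        moreover have "profit P t (X t) / h \<le> (real T + 1) ^ j"
        proof -
          have "success n T t i * d \<le> 4 * ?c * d"
            using success_le[OF t1 T, of n j] d j by (intro mult_right_mono) auto
          then have "profit P t (X t) \<le> (real T + 1) ^ j * h"
            using pr by (simp add: step_cost_def h_def algebra_simps)
          then show ?thesis using h by (simp add: pos_divide_le_eq)
        qed
        ultimately show ?thesis by blast
      qed
    qed
    \<comment> \<open>With \<open>D = 1 / (2 * d)\<close> the bound scales back to
      \<open>h / d\<close>, in which \<open>d\<close> cancels: it is the same for every bonus below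
      1.\<close>
    then have "(\<Sum>t\<in>{1..T}. profit P t (X t) / h) \<le> 2 * (1 / (2 * d))"
      using T d by (intro sum_power_bound[of "real T + 1"]) auto
    then have "(\<Sum>t\<in>{1..T}. profit P t (X t)) / h \<le> 1 / d"
      by (simp add: sum_divide_distrib)
    then have "(\<Sum>t\<in>{1..T}. profit P t (X t)) \<le> 1 / d * h"
      using h by (simp add: pos_divide_le_eq)
    then show ?thesis using d by (simp add: h_def P_def)
  qed
qed

lemma hard_problem_opt_menu:
  assumes T: "1 \<le> T"
  shows "opt_menu (hard_problem n T) \<le> 4 * unit_cost n T / real T"
  unfolding opt_menu_def
proof (rule cSUP_least)
  show "{X. ic_menu (hard_problem n T) X} \<noteq> {}" using ic_menu_zero by blast
  fix X assume "X \<in> {X. ic_menu (hard_problem n T) X}"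
  then show "menu_profit (hard_problem n T) X \<le> 4 * unit_cost n T / real T"
    using hard_problem_profit_sum[OF T]
    by (simp add: menu_profit_def type_expectation_def divide_right_mono)
qed

section \<open>Lower bound on welfare and the resulting ratio\<close>

text \<open>Taking all \<open>n\<close> steps already suffices: each contributes surplus of order
  \<open>1 / t\<close>, and summing over types gives the harmonic number.\<close>

lemma hard_problem_welfare:
  assumes T: "1 \<le> T"
  shows "real n * unit_cost n T / 2 * harm T / real T \<le> welfare (hard_problem n T)"
proof -
  define P where "P = hard_problem n T"
  have S: "{Suc 0..2} = {Suc 0, 2}" by auto
  have "real n * unit_cost n T / 2 * inverse (real t)
      \<le> Max ((\<lambda>i. expected_reward P t i - cost P i) ` {1..num_actions P})"
    if t: "t \<in> {1..T}" for t
  proof -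
    have t1: "1 \<le> t" using t by simp
    have "unit_cost n T / 2 * inverse (real t) \<le> step_cost n T k / step_bonus T t k - step_cost n T k"
      for k
    proof -
      let ?c = "step_cost n T k" and ?y = "step_bonus T t k"
      have "0 < (real T + 1) ^ k" by (simp add: add_nonneg_pos)
      \<comment> \<open>The power in the cost cancels against the one in \<open>1 - ?y\<close>, so
        all steps share the same bound.\<close>
      then have "unit_cost n T / 2 * inverse (real t) = ?c * (1 - ?y)"
        using t1 by (simp add: step_cost_def step_bonus_def field_simps)
      also have "\<dots> \<le> ?c * (1 - ?y) / ?y"
      proof -
        have "0 \<le> ?c * (1 - ?y)" "0 < ?y" "?y \<le> 1"
          using step_bonus_bounds[OF t1, of T k] step_cost_pos[of n T k] by auto
        then have "?c * (1 - ?y) / 1 \<le> ?c * (1 - ?y) / ?y"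
          by (intro divide_left_mono) auto
        then show ?thesis by simp
      qed
      also have "\<dots> = ?c / ?y - ?c"
        using step_bonus_bounds[OF t1, of T k] by (simp add: field_simps)
      finally show ?thesis .
    qed
    then have "(\<Sum>k<n. unit_cost n T / 2 * inverse (real t))
        \<le> (\<Sum>k<n. step_cost n T k / step_bonus T t k - step_cost n T k)"
      by (intro sum_mono) auto
    also have "\<dots> = expected_reward P t (Suc n) - cost P (Suc n)"
      by (simp add: P_def expected_reward_def S success_def sum_subtractf)
    also have "\<dots> \<le> Max ((\<lambda>i. expected_reward P t i - cost P i) ` {1..num_actions P})"
      by (intro Max_ge imageI) (simp_all add: P_def)
    finally show ?thesis by simp
  qed
  then have "(\<Sum>t\<in>{1..T}. real n * unit_cost n T / 2 * inverse (real t))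
      \<le> (\<Sum>t\<in>{1..T}. Max ((\<lambda>i. expected_reward P t i - cost P i) ` {1..num_actions P}))"
    by (rule sum_mono)
  then have "real n * unit_cost n T / 2 * harm T
      \<le> (\<Sum>t\<in>{1..T}. Max ((\<lambda>i. expected_reward P t i - cost P i) ` {1..num_actions P}))"
    by (simp only: harm_def sum_distrib_left)
  then have "real n * unit_cost n T / 2 * harm T / real T
      \<le> (\<Sum>t\<in>{1..T}. Max ((\<lambda>i. expected_reward P t i - cost P i) ` {1..num_actions P})) / real T"
    by (intro divide_right_mono) auto
  moreover have "num_types P = T" by (simp add: P_def)
  ultimately show ?thesis unfolding welfare_def type_expectation_def P_def by simp
qed

text \<open>At \<open>T = 1\<close> the logarithm vanishes and HOL evaluates the quotient to 0, so
  the bound is asserted from \<open>T = 2\<close> on. Positive welfare excludes degenerate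
  instances.\<close>

theorem corollary8:
  shows "\<exists>C::real. C > 0 \<and>
    (\<forall>n T :: nat. n > 0 \<longrightarrow> T > 0 \<longrightarrow>
      (\<exists>P :: pa_problem. principal_agent_problem P \<and>
           num_types P = T \<and> num_actions P = n + 1 \<and> num_outcomes P = 2 \<and>
           welfare P > 0 \<and>
           (T \<ge> 2 \<longrightarrow> opt_menu P \<le> C * (1 / (real n * ln (real T))) * welfare P)))"
\<comment> \<open>8 is the profit constant 4 divided by the welfare constant 1/2.\<close>
proof (intro exI[of _ "8::real"] conjI allI impI)
  fix n T :: nat
  assume n: "n > 0" and "T > 0"
  then have T: "1 \<le> T" by simp
  define P where "P = hard_problem n T"
  have w: "real n * unit_cost n T / 2 * harm T / real T \<le> welfare P"
    unfolding P_def by (rule hard_problem_welfare[OF T])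
  have "0 < real n * unit_cost n T / 2 * harm T / real T"
    using n T unit_cost_pos[of n T] harm_pos[of T, where 'a = real] by simp
  then have pos: "0 < welfare P" using w by linarith
  have "opt_menu P \<le> 8 * (1 / (real n * ln (real T))) * welfare P" if T2: "T \<ge> 2"
  proof -
    have l: "0 < ln (real T)" using T2 by simp
    have "ln (real T) \<le> ln (real T + 1)" using T by simp
    also have "\<dots> \<le> harm T" by (rule ln_le_harm)
    finally have "real n * unit_cost n T / 2 * ln (real T) / real T
        \<le> real n * unit_cost n T / 2 * harm T / real T"
      using unit_cost_pos[of n T] by (intro divide_right_mono mult_left_mono) auto
    then have "real n * unit_cost n T / 2 * ln (real T) / real T \<le> welfare P"
      using w by linarith
    then have "8 * (1 / (real n * ln (real T))) * (real n * unit_cost n T / 2 * ln (real T) / real T)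
        \<le> 8 * (1 / (real n * ln (real T))) * welfare P"
      using n l by (intro mult_left_mono) auto
    moreover have "8 * (1 / (real n * ln (real T))) * (real n * unit_cost n T / 2 * ln (real T) / real T)
        = 4 * unit_cost n T / real T"
      using n l T by (simp add: field_simps)
    ultimately show ?thesis
      using hard_problem_opt_menu[OF T, of n] unfolding P_def by linarith
  qed
  then show "\<exists>P :: pa_problem. principal_agent_problem P \<and>
           num_types P = T \<and> num_actions P = n + 1 \<and> num_outcomes P = 2 \<and>
           welfare P > 0 \<and>
           (T \<ge> 2 \<longrightarrow> opt_menu P \<le> 8 * (1 / (real n * ln (real T))) * welfare P)"
    using hard_problem_valid[OF T] pos by (intro exI[of _ P]) (simp add: P_def)
qed simp

end
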